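(* (Blame-Subtyping Theorem for both variants of $\lambda\mathsf{B}'$.) Consider either Variant 1 or Variant 2 of $\lambda\mathsf{B}'$. Let $M:\Gamma\vdash' A$ be a term of $\lambda\mathsf{B}'$ and $\ell$ a blame label. If $M$ is safe for $\ell$, then it is not the case that $M\longrightarrow^{*}\mathtt{blame}\,\ell$.
   Context: **Types.** Base types $b$: $\mathtt{Nat},\mathtt{Bool},\mathtt{Int},\mathtt{Unit},\bot$. Types: $A,B::=b\mid\,?\mid A\to B\mid A\times B\mid A+B$; atomic types $a::=b\mid\,?$; ground types $G::=b\mid\,?\to?\mid\,?\times?\mid\,?+?$; $\otimes$ ranges over $\{\to,\times,+\}$. Contexts are finite sequences of types; variables are de Bruijn indices (index $0$ is the last-added type). Primitive types $P::=b\mid b\to P$; each $b$ denotes a set (naturals, Booleans, integers, one-element set, empty set), $[\![b\to P]\!]$ is the set of functions $[\![b]\!]\to[\![P]\!]$. Blame labels range over a fixed set. *Consistency* $\sim$: $A\sim\,?$; $?\sim B$; $b\sim b$; $A\otimes B\sim A'\otimes B'$ if $A\sim A'$, $B\sim B'$. $\mathsf{gnd}\,b=b$, $\mathsf{gnd}(A\otimes B)=\,?\otimes\,?$. **Casts**: $c=(A\Rightarrow^\ell B)$ with $A\sim B$, a cast from $A$ to $B$. *Cross* casts: $A\otimes B\Rightarrow^\ell C\otimes D$, with $\mathsf{dom}\,c=(C\Rightarrow^\ell A)$, $\mathsf{cod}\,c=(B\Rightarrow^\ell D)$ for $\otimes=\to$; $\mathsf{fst}\,c=(A\Rightarrow^\ell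 C)$, $\mathsf{snd}\,c=(B\Rightarrow^\ell D)$ for $\otimes=\times$; $\mathsf{inl}\,c=(A\Rightarrow^\ell C)$, $\mathsf{inr}\,c=(B\Rightarrow^\ell D)$ for $\otimes=+$. *Variant 1*: inert casts are $G\Rightarrow^\ell\,?$ and all cross casts. *Variant 2*: inert casts are $G\Rightarrow^\ell\,?$ and casts between function types. *Active* casts in both variants: $a\Rightarrow^\ell a$; $A\Rightarrow^\ell\,?$ with $A\ne\,?$ not ground; $?\Rightarrow^\ell B$ with $B\neq\,?$; in Variant 2 also casts between two product types or two sum types. **Terms** (intrinsically typed; $M:\Gamma\vdash' A$): $\$k:P$ for $k\in[\![P]\!]$; $`x:A$ if $x$ has type $A$ in $\Gamma$; $\lambda M:A\to B$ if $M:\Gamma\cdot A\vdash' B$; $L\,M:B$ if $L:A\to B$, $M:A$; $\mathtt{if}\,L\,M\,N:B$ if $L:\mathtt{Bool}$, $M,N:B$; $\mathtt{cons}\,M\,N:A\times B$; $\pi_iM:A_i$ if $M:A_1\times A_2$; $\mathtt{inl}[B]M:A+B$ if $M:A$; $\mathtt{inr}[A]M:A+B$ if $M:B$; $\mathtt{case}\,L\,M\,N:B$ if $L:\Gamma\vdash' A_1+A_2$, $M:\Gamma\cdot A_1\vdash' B$, $N:\Gamma\cdot A_2\vdash' B$; $M\langle c\rangle:B$ if $M:A$ and $c$ is a cast from $A$ to $B$; $M\langle\!\langle c\rangle\!\rangle:B$ likewise with $c$ inert; $\mathtt{blame}\,\ell:A$ for every $A$. **Values** $V,W$: $\lambda M$;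 $\$k$; $\mathtt{cons}\,V\,W$; $\mathtt{inl}[B]V$; $\mathtt{inr}[A]V$; $V\langle\!\langle c\rangle\!\rangle$. **Frames** $F$: $\Box\,M$; $V\,\Box$; $\mathtt{if}\,\Box\,M\,N$; $\mathtt{cons}\,V\,\Box$; $\mathtt{cons}\,\Box\,N$; $\pi_i\Box$; $\mathtt{inl}[B]\Box$; $\mathtt{inr}[A]\Box$; $\mathtt{case}\,\Box\,M\,N$; $\Box\langle c\rangle$; $\Box\langle\!\langle c\rangle\!\rangle$. **Reduction** ($M[N]$ is substitution for variable $0$): - $F[M]\longrightarrow F[M']$ if $M\longrightarrow M'$; $F[\mathtt{blame}\,\ell]\longrightarrow\mathtt{blame}\,\ell$; $V\langle c\rangle\longrightarrow V\langle\!\langle c\rangle\!\rangle$ for $c$ inert. - $V\langle a\Rightarrow^\ell a\rangle\longrightarrow V$; $V\langle A\Rightarrow^\ell\,?\rangle\longrightarrow V\langle A\Rightarrow^\ell\mathsf{gnd}\,A\rangle\langle\mathsf{gnd}\,A\Rightarrow^\ell\,?\rangle$ for $A\neq\,?$ not ground. - $V\langle\!\langle G\Rightarrow^{\ell_1}?\rangle\!\rangle\langle?\Rightarrow^{\ell_2}B\rangle$ ($B\ne\,?$) reduces to $V$ if $B$ is ground and $B=G$; to $\mathtt{blame}\,\ell_2$ if $B$ is ground and $B\ne G$; and otherwise to $V\langle G\Rightarrow^{\ell_1}?\rangle\langle?\Rightarrow^{\ell_2}\mathsf{gnd}\,B\rangle\langle\mathsf{gnd}\,B\Rightarrow^{\ell_2}B\rangle$.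 - Variant 2 only: for $c$ between product types, $V\langle c\rangle\longrightarrow\mathtt{cons}\,((\pi_1V)\langle\mathsf{fst}\,c\rangle)\,((\pi_2V)\langle\mathsf{snd}\,c\rangle)$; for $c$ from $A+B$ to $C+D$, $V\langle c\rangle\longrightarrow\mathtt{case}\,V\,(\mathtt{inl}[D](`0\langle\mathsf{inl}\,c\rangle))\,(\mathtt{inr}[C](`0\langle\mathsf{inr}\,c\rangle))$. - For $c$ an inert cross cast: $V\langle\!\langle c\rangle\!\rangle\,W\longrightarrow(V\,(W\langle\mathsf{dom}\,c\rangle))\langle\mathsf{cod}\,c\rangle$; $\pi_1(V\langle\!\langle c\rangle\!\rangle)\longrightarrow(\pi_1V)\langle\mathsf{fst}\,c\rangle$; $\pi_2(V\langle\!\langle c\rangle\!\rangle)\longrightarrow(\pi_2V)\langle\mathsf{snd}\,c\rangle$; $\mathtt{case}\,(V\langle\!\langle c\rangle\!\rangle)\,M\,N\longrightarrow\mathtt{case}\,V\,M'\,N'$, where $M'$ (resp. $N'$) is $M$ (resp. $N$) with its bound variable $`0$ replaced by $`0\langle\mathsf{inl}\,c\rangle$ (resp. $`0\langle\mathsf{inr}\,c\rangle$). - $(\lambda M)V\longrightarrow M[V]$; $\mathtt{if}\,\$\mathtt{true}\,M\,N\longrightarrow M$; $\mathtt{if}\,\$\mathtt{false}\,M\,N\longrightarrow N$; $\pi_1(\mathtt{cons}\,V\,W)\longrightarrow V$; $\pi_2(\mathtt{cons}\,V\,W)\longrightarrow W$; $\mathtt{case}(\mathtt{inl}[B]V)\,M\,N\longrightarrow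 M[V]$; $\mathtt{case}(\mathtt{inr}[A]V)\,M\,N\longrightarrow N[V]$; $\$k\,\$k'\longrightarrow\$(k(k'))$. $\longrightarrow^{*}$ is the reflexive-transitive closure. **Subtyping** ("UD"): $?<:\,?$; $b<:b$; $A<:\,?$ if $A<:G$ for some ground type $G$; $A\to B<:C\to D$ if $C<:A$ and $B<:D$; $A\times B<:C\times D$ and $A+B<:C+D$ if $A<:C$ and $B<:D$. **Blame safety.** $\mathsf{CastBlameSafe}\,(A\Rightarrow^{\ell'}B)\,\ell$ holds iff $\ell'\neq\ell$ or $A<:B$. $M$ is *safe for* $\ell$ iff every cast $c$ occurring in $M$ (in a subterm $N\langle c\rangle$ or $N\langle\!\langle c\rangle\!\rangle$) satisfies $\mathsf{CastBlameSafe}\,c\,\ell$ and every subterm $\mathtt{blame}\,\ell'$ of $M$ has $\ell'\neq\ell$. *)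

theory Defs
  imports Main "HOL-Library.FuncSet"
begin

datatype base = TNat | TBool | TInt | TUnit | TBot

datatype ty =
    Base base
  | Dyn
  | Fun ty ty
  | Prod ty ty
  | Sum ty ty

inductive atomic :: "ty \<Rightarrow> bool" where
  atomic_base: "atomic (Base b)"
| atomic_dyn: "atomic Dyn"

inductive ground :: "ty \<Rightarrow> bool" where
  ground_base: "ground (Base b)"
| ground_fun: "ground (Fun Dyn Dyn)"
| ground_prod: "ground (Prod Dyn Dyn)"
| ground_sum: "ground (Sum Dyn Dyn)"

(* gnd Dyn is junk: every use below is guarded by A \<noteq> Dyn. *)
primrec gnd :: "ty \<Rightarrow> ty" where
  "gnd (Base b) = Base b"
| "gnd Dyn = undefined"
| "gnd (Fun A B) = Fun Dyn Dyn"
| "gnd (Prod A B) = Prod Dyn Dyn"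
| "gnd (Sum A B) = Sum Dyn Dyn"

inductive consistent :: "ty \<Rightarrow> ty \<Rightarrow> bool" (infix "\<sim>" 50) where
  cons_dyn_right: "A \<sim> Dyn"
| cons_dyn_left: "Dyn \<sim> B"
| cons_base: "Base b \<sim> Base b"
| cons_fun: "A \<sim> A' \<Longrightarrow> B \<sim> B' \<Longrightarrow> Fun A B \<sim> Fun A' B'"
| cons_prod: "A \<sim> A' \<Longrightarrow> B \<sim> B' \<Longrightarrow> Prod A B \<sim> Prod A' B'"
| cons_sum: "A \<sim> A' \<Longrightarrow> B \<sim> B' \<Longrightarrow> Sum A B \<sim> Sum A' B'"

inductive subtype :: "ty \<Rightarrow> ty \<Rightarrow> bool" (infix "<:" 50) where
  sub_dyn: "Dyn <: Dyn"
| sub_base: "Base b <: Base b"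
| sub_inj: "ground G \<Longrightarrow> A <: G \<Longrightarrow> A <: Dyn"
| sub_fun: "C <: A \<Longrightarrow> B <: D \<Longrightarrow> Fun A B <: Fun C D"
| sub_prod: "A <: C \<Longrightarrow> B <: D \<Longrightarrow> Prod A B <: Prod C D"
| sub_sum: "A <: C \<Longrightarrow> B <: D \<Longrightarrow> Sum A B <: Sum C D"

datatype prim = PBase base | PFun base prim

primrec ty_of_prim :: "prim \<Rightarrow> ty" where
  "ty_of_prim (PBase b) = Base b"
| "ty_of_prim (PFun b P) = Fun (Base b) (ty_of_prim P)"

datatype base_val = NatV nat | BoolV bool | IntV int | UnitV

primrec base_den :: "base \<Rightarrow> base_val set" where
  "base_den TNat = range NatV"
| "base_den TBool = range BoolV"
| "base_den TInt = range IntV"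
| "base_den TUnit = {UnitV}"
| "base_den TBot = {}"

datatype prim_val = BaseV base_val | FunV "base_val \<Rightarrow> prim_val"

(* The extensional function space makes prim_den (PFun b P) correspond exactly to the
   set-theoretic functions from base_den b to prim_den P; for b = TBot it is a singleton. *)
primrec prim_den :: "prim \<Rightarrow> prim_val set" where
  "prim_den (PBase b) = BaseV ` base_den b"
| "prim_den (PFun b P) = FunV ` (base_den b \<rightarrow>\<^sub>E prim_den P)"

(* Coerce A l B is the cast from A to B with blame label l.  The requirement A \<sim> B
   is part of the typing rules for the two cast forms. *)
datatype 'l cast = Coerce ty 'l ty

datatype variant = Variant1 | Variant2

inductive inert :: "variant \<Rightarrow> 'l cast \<Rightarrow> bool" for v :: variant where
  inert_inj: "ground G \<Longrightarrow> inert v (Coerce G l Dyn)"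
| inert_fun: "inert v (Coerce (Fun A B) l (Fun C D))"
| inert_prod: "v = Variant1 \<Longrightarrow> inert v (Coerce (Prod A B) l (Prod C D))"
| inert_sum: "v = Variant1 \<Longrightarrow> inert v (Coerce (Sum A B) l (Sum C D))"

fun is_fun_cast :: "'l cast \<Rightarrow> bool" where
  "is_fun_cast (Coerce (Fun A B) l (Fun C D)) = True"
| "is_fun_cast _ = False"

fun is_prod_cast :: "'l cast \<Rightarrow> bool" where
  "is_prod_cast (Coerce (Prod A B) l (Prod C D)) = True"
| "is_prod_cast _ = False"

fun is_sum_cast :: "'l cast \<Rightarrow> bool" where
  "is_sum_cast (Coerce (Sum A B) l (Sum C D)) = True"
| "is_sum_cast _ = False"

fun dom_cast :: "'l cast \<Rightarrow> 'l cast" where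
  "dom_cast (Coerce (Fun A B) l (Fun C D)) = Coerce C l A"

fun cod_cast :: "'l cast \<Rightarrow> 'l cast" where
  "cod_cast (Coerce (Fun A B) l (Fun C D)) = Coerce B l D"

fun fst_cast :: "'l cast \<Rightarrow> 'l cast" where
  "fst_cast (Coerce (Prod A B) l (Prod C D)) = Coerce A l C"

fun snd_cast :: "'l cast \<Rightarrow> 'l cast" where
  "snd_cast (Coerce (Prod A B) l (Prod C D)) = Coerce B l D"

fun inl_cast :: "'l cast \<Rightarrow> 'l cast" where
  "inl_cast (Coerce (Sum A B) l (Sum C D)) = Coerce A l C"

fun inr_cast :: "'l cast \<Rightarrow> 'l cast" where
  "inr_cast (Coerce (Sum A B) l (Sum C D)) = Coerce B l D"

(* Intrinsically typed terms are rendered as raw terms together with the judgement typing;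
   reduction inspects only the type annotations that raw terms carry.
   Lam and both branches of Case bind index 0.
   Cast M c is the pending cast, Wrap M c the cast form for inert casts that builds values. *)
datatype 'l tm =
    Const prim prim_val
  | Var nat
  | Lam "'l tm"
  | App "'l tm" "'l tm"
  | Ite "'l tm" "'l tm" "'l tm"
  | Pair "'l tm" "'l tm"
  | Proj1 "'l tm"
  | Proj2 "'l tm"
  | InL ty "'l tm"
  | InR ty "'l tm"
  | Case "'l tm" "'l tm" "'l tm"
  | Cast "'l tm" "'l cast"
  | Wrap "'l tm" "'l cast"
  | Blame 'l

(* The head of the context is the type of variable 0. *)
inductive typing :: "variant \<Rightarrow> ty list \<Rightarrow> 'l tm \<Rightarrow> ty \<Rightarrow> bool" for v :: variant where
  ty_const: "k \<in> prim_den P \<Longrightarrow> typing v \<Gamma> (Const P k) (ty_of_prim P)"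
| ty_var: "x < length \<Gamma> \<Longrightarrow> \<Gamma> ! x = A \<Longrightarrow> typing v \<Gamma> (Var x) A"
| ty_lam: "typing v (A # \<Gamma>) M B \<Longrightarrow> typing v \<Gamma> (Lam M) (Fun A B)"
| ty_app: "typing v \<Gamma> L (Fun A B) \<Longrightarrow> typing v \<Gamma> M A \<Longrightarrow> typing v \<Gamma> (App L M) B"
| ty_ite: "typing v \<Gamma> L (Base TBool) \<Longrightarrow> typing v \<Gamma> M B \<Longrightarrow> typing v \<Gamma> N B \<Longrightarrow>
    typing v \<Gamma> (Ite L M N) B"
| ty_pair: "typing v \<Gamma> M A \<Longrightarrow> typing v \<Gamma> N B \<Longrightarrow> typing v \<Gamma> (Pair M N) (Prod A B)"
| ty_proj1: "typing v \<Gamma> M (Prod A B) \<Longrightarrow> typing v \<Gamma> (Proj1 M) A"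
| ty_proj2: "typing v \<Gamma> M (Prod A B) \<Longrightarrow> typing v \<Gamma> (Proj2 M) B"
| ty_inl: "typing v \<Gamma> M A \<Longrightarrow> typing v \<Gamma> (InL B M) (Sum A B)"
| ty_inr: "typing v \<Gamma> M B \<Longrightarrow> typing v \<Gamma> (InR A M) (Sum A B)"
| ty_case: "typing v \<Gamma> L (Sum A1 A2) \<Longrightarrow> typing v (A1 # \<Gamma>) M B \<Longrightarrow> typing v (A2 # \<Gamma>) N B \<Longrightarrow>
    typing v \<Gamma> (Case L M N) B"
| ty_cast: "typing v \<Gamma> M A \<Longrightarrow> A \<sim> B \<Longrightarrow> typing v \<Gamma> (Cast M (Coerce A l B)) B"
| ty_wrap: "typing v \<Gamma> M A \<Longrightarrow> A \<sim> B \<Longrightarrow> inert v (Coerce A l B) \<Longrightarrow>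
    typing v \<Gamma> (Wrap M (Coerce A l B)) B"
| ty_blame: "typing v \<Gamma> (Blame l) A"

definition ext_ren :: "(nat \<Rightarrow> nat) \<Rightarrow> nat \<Rightarrow> nat" where
  "ext_ren \<rho> = case_nat 0 (\<lambda>x. Suc (\<rho> x))"

primrec rename :: "(nat \<Rightarrow> nat) \<Rightarrow> 'l tm \<Rightarrow> 'l tm" where
  "rename \<rho> (Const P k) = Const P k"
| "rename \<rho> (Var x) = Var (\<rho> x)"
| "rename \<rho> (Lam M) = Lam (rename (ext_ren \<rho>) M)"
| "rename \<rho> (App L M) = App (rename \<rho> L) (rename \<rho> M)"
| "rename \<rho> (Ite L M N) = Ite (rename \<rho> L) (rename \<rho> M) (rename \<rho> N)"
| "rename \<rho> (Pair M N) = Pair (rename \<rho> M) (rename \<rho> N)"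
| "rename \<rho> (Proj1 M) = Proj1 (rename \<rho> M)"
| "rename \<rho> (Proj2 M) = Proj2 (rename \<rho> M)"
| "rename \<rho> (InL B M) = InL B (rename \<rho> M)"
| "rename \<rho> (InR A M) = InR A (rename \<rho> M)"
| "rename \<rho> (Case L M N) = Case (rename \<rho> L) (rename (ext_ren \<rho>) M) (rename (ext_ren \<rho>) N)"
| "rename \<rho> (Cast M c) = Cast (rename \<rho> M) c"
| "rename \<rho> (Wrap M c) = Wrap (rename \<rho> M) c"
| "rename \<rho> (Blame l) = Blame l"

definition ext_sub :: "(nat \<Rightarrow> 'l tm) \<Rightarrow> nat \<Rightarrow> 'l tm" where
  "ext_sub \<sigma> = case_nat (Var 0) (\<lambda>x. rename Suc (\<sigma> x))"

primrec subst :: "(nat \<Rightarrow> 'l tm) \<Rightarrow> 'l tm \<Rightarrow> 'l tm" where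
  "subst \<sigma> (Const P k) = Const P k"
| "subst \<sigma> (Var x) = \<sigma> x"
| "subst \<sigma> (Lam M) = Lam (subst (ext_sub \<sigma>) M)"
| "subst \<sigma> (App L M) = App (subst \<sigma> L) (subst \<sigma> M)"
| "subst \<sigma> (Ite L M N) = Ite (subst \<sigma> L) (subst \<sigma> M) (subst \<sigma> N)"
| "subst \<sigma> (Pair M N) = Pair (subst \<sigma> M) (subst \<sigma> N)"
| "subst \<sigma> (Proj1 M) = Proj1 (subst \<sigma> M)"
| "subst \<sigma> (Proj2 M) = Proj2 (subst \<sigma> M)"
| "subst \<sigma> (InL B M) = InL B (subst \<sigma> M)"
| "subst \<sigma> (InR A M) = InR A (subst \<sigma> M)"
| "subst \<sigma> (Case L M N) = Case (subst \<sigma> L) (subst (ext_sub \<sigma>) M) (subst (ext_sub \<sigma>) N)"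
| "subst \<sigma> (Cast M c) = Cast (subst \<sigma> M) c"
| "subst \<sigma> (Wrap M c) = Wrap (subst \<sigma> M) c"
| "subst \<sigma> (Blame l) = Blame l"

(* M[N]: variable 0 is removed, so the remaining indices go down by one. *)
definition subst0 :: "'l tm \<Rightarrow> 'l tm \<Rightarrow> 'l tm" where
  "subst0 M N = subst (case_nat N Var) M"

(* Replaces variable 0 by itself under the cast c; no index is shifted. *)
definition cast0 :: "'l cast \<Rightarrow> 'l tm \<Rightarrow> 'l tm" where
  "cast0 c M = subst (case_nat (Cast (Var 0) c) (\<lambda>x. Var (Suc x))) M"

(* That c is inert in Wrap V c is enforced by typing. *)
inductive val :: "'l tm \<Rightarrow> bool" where
  val_lam: "val (Lam M)"
| val_const: "val (Const P k)"
| val_pair: "val V \<Longrightarrow> val W \<Longrightarrow> val (Pair V W)"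
| val_inl: "val V \<Longrightarrow> val (InL B V)"
| val_inr: "val V \<Longrightarrow> val (InR A V)"
| val_wrap: "val V \<Longrightarrow> val (Wrap V c)"

datatype 'l frame =
    FAppL "'l tm"
  | FAppR "'l tm"
  | FIte "'l tm" "'l tm"
  | FPairR "'l tm"
  | FPairL "'l tm"
  | FProj1
  | FProj2
  | FInL ty
  | FInR ty
  | FCase "'l tm" "'l tm"
  | FCast "'l cast"
  | FWrap "'l cast"

(* The frames with the hole on the right need a value on the left. *)
fun is_frame :: "'l frame \<Rightarrow> bool" where
  "is_frame (FAppR V) = val V"
| "is_frame (FPairR V) = val V"
| "is_frame _ = True"

primrec plug :: "'l frame \<Rightarrow> 'l tm \<Rightarrow> 'l tm" where
  "plug (FAppL M) X = App X M"
| "plug (FAppR V) X = App V X"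
| "plug (FIte M N) X = Ite X M N"
| "plug (FPairR V) X = Pair V X"
| "plug (FPairL N) X = Pair X N"
| "plug FProj1 X = Proj1 X"
| "plug FProj2 X = Proj2 X"
| "plug (FInL B) X = InL B X"
| "plug (FInR A) X = InR A X"
| "plug (FCase M N) X = Case X M N"
| "plug (FCast c) X = Cast X c"
| "plug (FWrap c) X = Wrap X c"

inductive step :: "variant \<Rightarrow> 'l tm \<Rightarrow> 'l tm \<Rightarrow> bool" for v :: variant where
  step_frame: "is_frame F \<Longrightarrow> step v M M' \<Longrightarrow> step v (plug F M) (plug F M')"
| step_blame: "is_frame F \<Longrightarrow> step v (plug F (Blame l)) (Blame l)"
| step_wrap: "val V \<Longrightarrow> inert v c \<Longrightarrow> step v (Cast V c) (Wrap V c)"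
| step_id: "val V \<Longrightarrow> atomic a \<Longrightarrow> step v (Cast V (Coerce a l a)) V"
| step_inj: "val V \<Longrightarrow> A \<noteq> Dyn \<Longrightarrow> \<not> ground A \<Longrightarrow>
    step v (Cast V (Coerce A l Dyn)) (Cast (Cast V (Coerce A l (gnd A))) (Coerce (gnd A) l Dyn))"
| step_collapse: "val V \<Longrightarrow> ground G \<Longrightarrow> ground B \<Longrightarrow> B = G \<Longrightarrow>
    step v (Cast (Wrap V (Coerce G l1 Dyn)) (Coerce Dyn l2 B)) V"
| step_conflict: "val V \<Longrightarrow> ground G \<Longrightarrow> ground B \<Longrightarrow> B \<noteq> G \<Longrightarrow>
    step v (Cast (Wrap V (Coerce G l1 Dyn)) (Coerce Dyn l2 B)) (Blame l2)"
| step_proj: "val V \<Longrightarrow> ground G \<Longrightarrow> B \<noteq> Dyn \<Longrightarrow> \<not> ground B \<Longrightarrow>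
    step v (Cast (Wrap V (Coerce G l1 Dyn)) (Coerce Dyn l2 B))
      (Cast (Cast (Cast V (Coerce G l1 Dyn)) (Coerce Dyn l2 (gnd B))) (Coerce (gnd B) l2 B))"
| step_cast_prod: "v = Variant2 \<Longrightarrow> val V \<Longrightarrow> is_prod_cast c \<Longrightarrow>
    step v (Cast V c) (Pair (Cast (Proj1 V) (fst_cast c)) (Cast (Proj2 V) (snd_cast c)))"
| step_cast_sum: "v = Variant2 \<Longrightarrow> val V \<Longrightarrow> c = Coerce (Sum A B) l (Sum C D) \<Longrightarrow>
    step v (Cast V c)
      (Case V (InL D (Cast (Var 0) (inl_cast c))) (InR C (Cast (Var 0) (inr_cast c))))"
| step_wrap_app: "val V \<Longrightarrow> val W \<Longrightarrow> inert v c \<Longrightarrow> is_fun_cast c \<Longrightarrow>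
    step v (App (Wrap V c) W) (Cast (App V (Cast W (dom_cast c))) (cod_cast c))"
| step_wrap_proj1: "val V \<Longrightarrow> inert v c \<Longrightarrow> is_prod_cast c \<Longrightarrow>
    step v (Proj1 (Wrap V c)) (Cast (Proj1 V) (fst_cast c))"
| step_wrap_proj2: "val V \<Longrightarrow> inert v c \<Longrightarrow> is_prod_cast c \<Longrightarrow>
    step v (Proj2 (Wrap V c)) (Cast (Proj2 V) (snd_cast c))"
| step_wrap_case: "val V \<Longrightarrow> inert v c \<Longrightarrow> is_sum_cast c \<Longrightarrow>
    step v (Case (Wrap V c) M N) (Case V (cast0 (inl_cast c) M) (cast0 (inr_cast c) N))"
| step_beta: "val V \<Longrightarrow> step v (App (Lam M) V) (subst0 M V)"
| step_ite_true: "step v (Ite (Const (PBase TBool) (BaseV (BoolV True))) M N) M"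
| step_ite_false: "step v (Ite (Const (PBase TBool) (BaseV (BoolV False))) M N) N"
| step_proj1: "val V \<Longrightarrow> val W \<Longrightarrow> step v (Proj1 (Pair V W)) V"
| step_proj2: "val V \<Longrightarrow> val W \<Longrightarrow> step v (Proj2 (Pair V W)) W"
| step_case_inl: "val V \<Longrightarrow> step v (Case (InL B V) M N) (subst0 M V)"
| step_case_inr: "val V \<Longrightarrow> step v (Case (InR A V) M N) (subst0 N V)"
| step_delta: "step v (App (Const (PFun b P) (FunV f)) (Const (PBase b) (BaseV u))) (Const P (f u))"

primrec subterms :: "'l tm \<Rightarrow> 'l tm set" where
  "subterms (Const P k) = {Const P k}"
| "subterms (Var x) = {Var x}"
| "subterms (Lam M) = insert (Lam M) (subterms M)"
| "subterms (App L M) = insert (App L M) (subterms L \<union> subterms M)"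
| "subterms (Ite L M N) = insert (Ite L M N) (subterms L \<union> subterms M \<union> subterms N)"
| "subterms (Pair M N) = insert (Pair M N) (subterms M \<union> subterms N)"
| "subterms (Proj1 M) = insert (Proj1 M) (subterms M)"
| "subterms (Proj2 M) = insert (Proj2 M) (subterms M)"
| "subterms (InL B M) = insert (InL B M) (subterms M)"
| "subterms (InR A M) = insert (InR A M) (subterms M)"
| "subterms (Case L M N) = insert (Case L M N) (subterms L \<union> subterms M \<union> subterms N)"
| "subterms (Cast M c) = insert (Cast M c) (subterms M)"
| "subterms (Wrap M c) = insert (Wrap M c) (subterms M)"
| "subterms (Blame l) = {Blame l}"

primrec cast_blame_safe :: "'l cast \<Rightarrow> 'l \<Rightarrow> bool" where
  "cast_blame_safe (Coerce A l' B) l \<longleftrightarrow> l' \<noteq> l \<or> A <: B"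

definition safe_for :: "'l tm \<Rightarrow> 'l \<Rightarrow> bool" where
  "safe_for M l \<longleftrightarrow>
     (\<forall>N c. Cast N c \<in> subterms M \<or> Wrap N c \<in> subterms M \<longrightarrow> cast_blame_safe c l) \<and>
     (\<forall>l'. Blame l' \<in> subterms M \<longrightarrow> l' \<noteq> l)"

end

theory Submission
  imports Defs
begin

text \<open>
  Safety for a label is preserved by reduction already on raw terms. The only rule that creates
  blame fails on a projection cast from the dynamic type to some other type; such a cast is never
  an instance of subtyping, so its label differs from the safe one.
\<close>

lemma safe_for_simps [simp]:
  "safe_for (Const P k) l"
  "safe_for (Var x) l"
  "safe_for (Lam M) l \<longleftrightarrow> safe_for M l"
  "safe_for (App L M) l \<longleftrightarrow> safe_for L l \<and> safe_for M l"
  "safe_for (Ite L M N) l \<longleftrightarrow> safe_for L l \<and> safe_for M l \<and> safe_for N l"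
  "safe_for (Pair M N) l \<longleftrightarrow> safe_for M l \<and> safe_for N l"
  "safe_for (Proj1 M) l \<longleftrightarrow> safe_for M l"
  "safe_for (Proj2 M) l \<longleftrightarrow> safe_for M l"
  "safe_for (InL B M) l \<longleftrightarrow> safe_for M l"
  "safe_for (InR B M) l \<longleftrightarrow> safe_for M l"
  "safe_for (Case L M N) l \<longleftrightarrow> safe_for L l \<and> safe_for M l \<and> safe_for N l"
  "safe_for (Cast M c) l \<longleftrightarrow> cast_blame_safe c l \<and> safe_for M l"
  "safe_for (Wrap M c) l \<longleftrightarrow> cast_blame_safe c l \<and> safe_for M l"
  "safe_for (Blame l') l \<longleftrightarrow> l' \<noteq> l"
  by (auto simp: safe_for_def)

lemma safe_for_rename [simp]: "safe_for (rename \<rho> M) l \<longleftrightarrow> safe_for M l"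
  by (induction M arbitrary: \<rho>) auto

text \<open>Safety of every \<open>\<sigma> x\<close> survives going under a binder:
  \<open>ext_sub\<close> adds only a variable and renamed terms, and renaming changes no cast or
  blame label.\<close>

lemma safe_for_subst:
  "safe_for M l \<Longrightarrow> (\<And>x. safe_for (\<sigma> x) l) \<Longrightarrow> safe_for (subst \<sigma> M) l"
  by (induction M arbitrary: \<sigma>) (auto simp: ext_sub_def split: nat.split)

lemma safe_for_subst0: "safe_for M l \<Longrightarrow> safe_for N l \<Longrightarrow> safe_for (subst0 M N) l"
  unfolding subst0_def by (rule safe_for_subst) (auto split: nat.split)

lemma safe_for_cast0: "safe_for M l \<Longrightarrow> cast_blame_safe c l \<Longrightarrow> safe_for (cast0 c M) l"
  unfolding cast0_def by (rule safe_for_subst) (auto split: nat.split)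

inductive_cases subtype_FunE: "Fun A B <: Fun C D"
inductive_cases subtype_ProdE: "Prod A B <: Prod C D"
inductive_cases subtype_SumE: "Sum A B <: Sum C D"
inductive_cases subtype_DynE: "A <: Dyn"

text \<open>Every subtyping rule that allows \<open>Dyn\<close> on the left has \<open>Dyn\<close>
  on the right. So a safe cast from \<open>Dyn\<close> to another type must carry a different
  label.\<close>

lemma Dyn_subtype_iff: "Dyn <: B \<longleftrightarrow> B = Dyn"
  by (auto intro: sub_dyn elim: subtype.cases)

lemma ground_subtype_Dyn: "ground G \<Longrightarrow> G <: Dyn"
  by (rule sub_inj[of G]) (auto elim!: ground.cases intro: subtype.intros)

lemma ground_gnd: "A \<noteq> Dyn \<Longrightarrow> ground (gnd A)"
  by (cases A) (auto intro: ground.intros)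

text \<open>A ground type is fixed by its head constructor, and the rules whose right side is not
  \<open>Dyn\<close> keep that constructor.\<close>

lemma subtype_ground_eq_gnd: "A <: G \<Longrightarrow> ground G \<Longrightarrow> G = gnd A"
  by (induction rule: subtype.induct) (auto elim: ground.cases)

lemma subtype_gnd: "A <: Dyn \<Longrightarrow> A \<noteq> Dyn \<Longrightarrow> A <: gnd A"
  by (auto elim!: subtype_DynE dest: subtype_ground_eq_gnd)

text \<open>Component casts keep the label of \<open>c\<close>, and inverting the subtyping of
  \<open>c\<close> gives theirs; the reversal in \<open>dom_cast\<close> matches the contravariance
  of \<open>sub_fun\<close>.\<close>

lemma cast_blame_safe_components:
  assumes "cast_blame_safe c l"
  shows "is_fun_cast c \<Longrightarrow> cast_blame_safe (dom_cast c) l"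
    and "is_fun_cast c \<Longrightarrow> cast_blame_safe (cod_cast c) l"
    and "is_prod_cast c \<Longrightarrow> cast_blame_safe (fst_cast c) l"
    and "is_prod_cast c \<Longrightarrow> cast_blame_safe (snd_cast c) l"
    and "is_sum_cast c \<Longrightarrow> cast_blame_safe (inl_cast c) l"
    and "is_sum_cast c \<Longrightarrow> cast_blame_safe (inr_cast c) l"
  using assms
  by (auto elim!: is_fun_cast.elims is_prod_cast.elims is_sum_cast.elims
      elim: subtype_FunE subtype_ProdE subtype_SumE)

lemma step_preserves_safe_for:
  "step v M N \<Longrightarrow> safe_for M l \<Longrightarrow> safe_for N l"
proof (induction rule: step.induct)
  case (step_frame F M M')
  then show ?case by (cases F) auto
next
  case (step_blame F l')
  then show ?case by (cases F) auto
next
  \<comment> \<open>If \<open>A <: Dyn\<close>, both halves of the factored cast are subtypings: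
    \<open>A <: gnd A\<close> and \<open>gnd A <: Dyn\<close>.\<close>
  case (step_inj V A l')
  then show ?case by (auto intro: subtype_gnd ground_subtype_Dyn ground_gnd)
next
  case (step_cast_sum V c A B l' C D)
  then show ?case by (auto elim: subtype_SumE)
\<comment> \<open>In \<open>step_conflict\<close> and \<open>step_proj\<close> the source cast
  leaves \<open>Dyn\<close> for another type, so \<open>l2\<close> differs from \<open>l\<close>;
  this also makes the new casts labelled \<open>l2\<close> safe. Inverting \<open>ground\<close>
  excludes \<open>Dyn\<close> as a ground target.\<close>
qed (auto simp: Dyn_subtype_iff cast_blame_safe_components safe_for_subst0 safe_for_cast0
    elim: ground.cases)

theorem corollary55:
  fixes v :: variant and \<Gamma> :: "ty list" and M :: "'l tm" and A :: ty and l :: 'l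
  assumes "typing v \<Gamma> M A"
    and "safe_for M l"
  shows "\<not> (step v)\<^sup>*\<^sup>* M (Blame l)"
proof
  assume "(step v)\<^sup>*\<^sup>* M (Blame l)"
  then have "safe_for (Blame l) l"
    using assms(2) by (induction rule: rtranclp_induct) (auto intro: step_preserves_safe_for)
  then show False by simp
qed

end
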